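(* Every randomized online algorithm for the simple unbounded knapsack problem has competitive ratio in expectation at least $1+\ln 2>1.693$.
   Context: Online simple unbounded knapsack problem: knapsack capacity $1$; an instance is a sequence of items $x_1,\dots,x_n$ ($n$ unknown to the algorithm) with sizes $s_i\in[0,1]$ and values $v_i=s_i$. Items arrive one by one; upon arrival of $x_i$ the algorithm irrevocably chooses a number $k_i\in\mathbb{N}_0$ of copies to pack, with the total packed size never exceeding $1$. $\mathrm{opt}(I)=\max\{\sum_i k_i v_i: k_i\in\mathbb{N}_0,\sum_i k_i s_i\le1\}$. For a randomized algorithm, $\mathrm{gain}(I)$ is the expected total packed value, the competitive ratio in expectation on $I$ is $\mathrm{opt}(I)/\mathrm{gain}(I)$, and the competitive ratio in expectation of the algorithm is the supremum of this over all instances. *)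

theory Defs
  imports "HOL-Probability.Probability"
begin

text \<open>An item is represented by its size alone, since its value equals its size. For the same
  reason \<open>load\<close> is both the total size and the total value of \<open>k i\<close> copies of each item \<open>i\<close>.\<close>

definition knapsack_instance :: "real list \<Rightarrow> bool" where
  "knapsack_instance xs \<longleftrightarrow> set xs \<subseteq> {0..1}"

definition load :: "(nat \<Rightarrow> nat) \<Rightarrow> real list \<Rightarrow> real" where
  "load k xs = (\<Sum>i<length xs. real (k i) * xs ! i)"

definition opt :: "real list \<Rightarrow> real" where
  "opt xs = Max {load k xs | k. load k xs \<le> 1}"

text \<open>The maximum exists: items of size 0 may be taken arbitrarily often, but add no value.\<close>

lemma opt_set_nonempty: "{load k xs | k. load k xs \<le> 1} \<noteq> {}"
proof -
  have "load (\<lambda>_. 0) xs \<le> 1" by (simp add: load_def)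
  then show ?thesis by blast
qed

lemma finite_opt_set:
  assumes "knapsack_instance xs"
  shows "finite {load k xs | k. load k xs \<le> 1}"
proof -
  let ?K = "PiE {..<length xs} (\<lambda>i. {..nat \<lfloor>1 / xs ! i\<rfloor>})"
  have nonneg: "0 \<le> xs ! i" if "i < length xs" for i
    using assms that unfolding knapsack_instance_def by (meson atLeastAtMost_iff nth_mem subsetD)
  have "{load k xs | k. load k xs \<le> 1} \<subseteq> (\<lambda>k. load k xs) ` ?K"
  proof clarify
    fix k assume k: "load k xs \<le> 1"
    define k' where "k' = (\<lambda>i\<in>{..<length xs}. if xs ! i = 0 then 0 else k i)"
    have "load k xs = load k' xs"
      unfolding load_def by (rule sum.cong) (auto simp: k'_def)
    moreover have "k' \<in> ?K"
    proof (rule PiE_I)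
      fix i assume i: "i \<in> {..<length xs}"
      show "k' i \<in> {..nat \<lfloor>1 / xs ! i\<rfloor>}"
      proof (cases "xs ! i = 0")
        case False
        with i nonneg have pos: "xs ! i > 0" by force
        have "real (k i) * xs ! i \<le> load k xs"
          unfolding load_def using i nonneg
          by (intro member_le_sum[of i "{..<length xs}" "\<lambda>i. real (k i) * xs ! i"]) auto
        with k pos have "real (k i) \<le> 1 / xs ! i" by (simp add: field_simps)
        then show ?thesis using i False by (simp add: k'_def le_nat_floor)
      qed (use i in \<open>simp add: k'_def\<close>)
    qed (simp add: k'_def)
    ultimately show "load k xs \<in> (\<lambda>k. load k xs) ` ?K" by blast
  qed
  then show ?thesis by (rule finite_subset) (auto intro!: finite_imageI finite_PiE)
qed

text \<open>A deterministic online algorithm maps the nonempty sequence of items presented so far to the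
  number of copies of its last item that are packed. It sees neither later items nor the length of
  the instance; its earlier choices are determined by the same sequence.\<close>

definition packed :: "(real list \<Rightarrow> nat) \<Rightarrow> real list \<Rightarrow> real" where
  "packed d xs = load (\<lambda>i. d (take (Suc i) xs)) xs"

text \<open>Prefixes of instances are instances, so the bound holds after every single decision.\<close>

definition online_algorithm :: "(real list \<Rightarrow> nat) \<Rightarrow> bool" where
  "online_algorithm d \<longleftrightarrow> (\<forall>xs. knapsack_instance xs \<longrightarrow> packed d xs \<le> 1)"

text \<open>A randomized algorithm is a random choice of a deterministic one: an outcome in the
  probability space \<open>M\<close> comprises all random choices the algorithm will ever use.\<close>

definition randomized_online_algorithm :: "'r measure \<Rightarrow> ('r \<Rightarrow> real list \<Rightarrow> nat) \<Rightarrow> bool" where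
  "randomized_online_algorithm M A \<longleftrightarrow>
     prob_space M \<and>
     (\<forall>\<omega>\<in>space M. online_algorithm (A \<omega>)) \<and>
     (\<forall>xs. knapsack_instance xs \<and> xs \<noteq> [] \<longrightarrow> (\<lambda>\<omega>. A \<omega> xs) \<in> measurable M (count_space UNIV))"

definition gain :: "'r measure \<Rightarrow> ('r \<Rightarrow> real list \<Rightarrow> nat) \<Rightarrow> real list \<Rightarrow> real" where
  "gain M A xs = (\<integral>\<omega>. packed (A \<omega>) xs \<partial>M)"

text \<open>In \<open>ereal\<close>, \<open>x / 0 = \<infinity>\<close> for \<open>x > 0\<close> and \<open>0 / 0 = 0\<close>, so an instance with optimum 0 (including
  the empty one) does not contribute to the supremum.\<close>

definition competitive_ratio :: "'r measure \<Rightarrow> ('r \<Rightarrow> real list \<Rightarrow> nat) \<Rightarrow> ereal" where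
  "competitive_ratio M A =
     (SUP xs\<in>{xs. knapsack_instance xs}. ereal (opt xs) / ereal (gain M A xs))"

end

theory Submission imports Defs "HOL-Real_Asymp.Real_Asymp" begin

text \<open>Present increasing items from just above \<open>1/2\<close> up to \<open>1\<close>, stopping at an unknown moment. At most
  one copy of one item fits, so the packing probabilities \<open>p i\<close> sum to at most 1. If the ratio is
  at most \<open>c\<close>, the gains \<open>g j = (\<Sum>i\<le>j. p i * x i)\<close> satisfy \<open>g j \<ge> x j / c\<close>; writing \<open>\<Sum>i. p i\<close> as a
  combination of the \<open>g j\<close> by Abel summation yields \<open>c \<ge> 1 + (\<Sum>j. 1 - x j / x (j + 1))\<close>. For a
  geometric progression with ever finer steps the right-hand side tends to \<open>1 + ln 2\<close>.\<close>

lemma load_prefix: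
  "load k (map x [0..<m]) = (\<Sum>i<m. real (k i) * x i)"
  by (simp add: load_def)

text \<open>Truncating a prefix gives a shorter prefix, so the decision on item \<open>i\<close> is
  the same for every \<open>m > i\<close>. Hence one sequence of decisions serves all stopping
  times.\<close>

lemma packed_prefix:
  "packed d (map x [0..<m]) = (\<Sum>i<m. real (d (map x [0..<Suc i])) * x i)"
  unfolding packed_def load_prefix
  by (rule sum.cong) (simp_all add: take_map min_def del: upt_Suc)

lemma knapsack_instance_nth:
  assumes "knapsack_instance xs" "i < length xs"
  shows "0 \<le> xs ! i" "xs ! i \<le> 1"
  using subsetD[OF assms(1)[unfolded knapsack_instance_def] nth_mem[OF assms(2)]] by simp_all

lemma nth_le_opt:
  assumes "knapsack_instance xs" "i < length xs"
  shows "xs ! i \<le> opt xs"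
proof -
  let ?k = "\<lambda>j. if j = i then 1 else 0 :: nat"
  have "load ?k xs = (\<Sum>j<length xs. if j = i then xs ! j else 0)"
    unfolding load_def by (rule sum.cong) auto
  also have "\<dots> = xs ! i"
    using assms(2) by simp
  finally have "load ?k xs = xs ! i" .
  moreover have "xs ! i \<le> 1"
    using assms by (rule knapsack_instance_nth)
  ultimately have "xs ! i \<in> {load k xs | k. load k xs \<le> 1}"
    by (intro CollectI exI[of _ ?k]) simp
  then show ?thesis
    unfolding opt_def by (intro Max_ge finite_opt_set assms(1))
qed

lemma packed_nonneg:
  assumes "knapsack_instance xs"
  shows "0 \<le> packed d xs"
  unfolding packed_def load_def
  by (intro sum_nonneg mult_nonneg_nonneg) (simp_all add: knapsack_instance_nth[OF assms])

lemma knapsack_instance_take: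
  "knapsack_instance xs \<Longrightarrow> knapsack_instance (take n xs)"
  unfolding knapsack_instance_def by (rule order_trans[OF set_take_subset])

lemma integrable_packed:
  assumes "randomized_online_algorithm M A" "knapsack_instance xs"
  shows "integrable M (\<lambda>\<omega>. packed (A \<omega>) xs)"
proof -
  interpret prob_space M
    using assms(1) by (simp add: randomized_online_algorithm_def)
  have "(\<lambda>\<omega>. real (A \<omega> (take (Suc i) xs))) \<in> borel_measurable M" if "i < length xs" for i
  proof -
    have "take (Suc i) xs \<noteq> []"
      using that by auto
    then have "(\<lambda>\<omega>. A \<omega> (take (Suc i) xs)) \<in> measurable M (count_space UNIV)"
      using assms knapsack_instance_take unfolding randomized_online_algorithm_def by blast
    then show ?thesis by simp
  qed
  then have "(\<lambda>\<omega>. packed (A \<omega>) xs) \<in> borel_measurable M"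
    unfolding packed_def load_def by (intro borel_measurable_sum borel_measurable_times) auto
  \<comment> \<open>The capacity bounds every outcome, and bounded measurable functions on a
    probability space are integrable.\<close>
  moreover have "norm (packed (A \<omega>) xs) \<le> 1" if "\<omega> \<in> space M" for \<omega>
    using assms that packed_nonneg[OF assms(2)]
    unfolding randomized_online_algorithm_def online_algorithm_def by simp
  ultimately show ?thesis
    by (intro integrable_const_bound[where B = 1]) auto
qed

text \<open>The term \<open>k i * x i\<close> occurs in every partial sum with
  \<open>j \<ge> i\<close>; its weights telescope from \<open>1 / x i\<close> down to
  \<open>1 / x n\<close>, and the last summand restores \<open>1 / x n\<close>.\<close>

lemma abel_summation_inverse:
  fixes k x :: "nat \<Rightarrow> 'a::field"
  assumes "\<And>i. i \<le> n \<Longrightarrow> x i \<noteq> 0"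
  shows "(\<Sum>j<n. (1 / x j - 1 / x (Suc j)) * (\<Sum>i<Suc j. k i * x i)) + (\<Sum>i<Suc n. k i * x i) / x n
    = (\<Sum>i<Suc n. k i)"
  using assms
proof (induction n)
  case (Suc n)
  define S where "S j = (\<Sum>i<Suc j. k i * x i)" for j
  have "x n \<noteq> 0" "x (Suc n) \<noteq> 0"
    using Suc.prems by auto
  moreover have "S (Suc n) = S n + k (Suc n) * x (Suc n)"
    by (simp add: S_def)
  ultimately have "(1 / x n - 1 / x (Suc n)) * S n + S (Suc n) / x (Suc n) = S n / x n + k (Suc n)"
    by (simp add: field_simps)
  moreover have "(\<Sum>j<n. (1 / x j - 1 / x (Suc j)) * S j) + S n / x n = (\<Sum>i<Suc n. k i)"
    using Suc unfolding S_def by simp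
  ultimately show ?case
    unfolding S_def[symmetric] sum.lessThan_Suc[of _ n] sum.lessThan_Suc[of _ "Suc n"]
    by (simp add: add.assoc)
qed simp

lemma increasing_items_bound:
  fixes x :: "nat \<Rightarrow> real"
  assumes A: "randomized_online_algorithm M A"
    and half: "\<And>i. i \<le> n \<Longrightarrow> 1 / 2 < x i" and le1: "\<And>i. i \<le> n \<Longrightarrow> x i \<le> 1"
    and incr: "\<And>i. i < n \<Longrightarrow> x i \<le> x (Suc i)"
    and gain: "\<And>j. j \<le> n \<Longrightarrow> x j \<le> c * gain M A (map x [0..<Suc j])"
    and "0 \<le> c"
  shows "1 + (\<Sum>j<n. 1 - x j / x (Suc j)) \<le> c"
proof -
  interpret prob_space M
    using A by (simp add: randomized_online_algorithm_def)
  define p where "p j = map x [0..<Suc j]" for j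
  define w where "w j = 1 / x j - 1 / x (Suc j)" for j
  have pos: "0 < x i" if "i \<le> n" for i
    using half[OF that] by simp
  have inst: "knapsack_instance (p j)" if "j \<le> n" for j
    using that le1 pos unfolding p_def knapsack_instance_def
    by (auto simp del: upt_Suc simp: less_imp_le)
  have w: "0 \<le> w j" if "j < n" for j
    using incr[OF that] pos[of j] that unfolding w_def by (simp add: frac_le)
  \<comment> \<open>Kept as a functional of \<open>f\<close>, since it is applied to the load of a
    single outcome, to the gain and to \<open>last\<close>.\<close>
  let ?S = "\<lambda>f. (\<Sum>j<n. w j * f (p j)) + f (p n) / x n"
  have pathwise: "?S (packed (A \<omega>)) \<le> 1" if \<omega>: "\<omega> \<in> space M" for \<omega>
  proof -
    have "?S (packed (A \<omega>)) = (\<Sum>i<Suc n. real (A \<omega> (p i)))"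
      unfolding p_def packed_prefix w_def
      by (rule abel_summation_inverse) (use pos in force)
    \<comment> \<open>Each copy is larger than 1/2. Strictness needs at least one copy, hence the
      case split.\<close>
    moreover have "(\<Sum>i<Suc n. real (A \<omega> (p i))) < 2"
    proof (cases "\<forall>i<Suc n. A \<omega> (p i) = 0")
      case False
      then obtain l where l: "l < Suc n" "A \<omega> (p l) \<noteq> 0"
        by blast
      have "(\<Sum>i<Suc n. real (A \<omega> (p i)) * (1 / 2)) < (\<Sum>i<Suc n. real (A \<omega> (p i)) * x i)"
      proof (rule sum_strict_mono_ex1)
        show "\<forall>i\<in>{..<Suc n}. real (A \<omega> (p i)) * (1 / 2) \<le> real (A \<omega> (p i)) * x i"
          using half by (intro ballI mult_left_mono) (auto simp: less_imp_le)
        show "\<exists>i\<in>{..<Suc n}. real (A \<omega> (p i)) * (1 / 2) < real (A \<omega> (p i)) * x i"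
          using l half[of l] by (intro bexI[of _ l] mult_strict_left_mono) auto
      qed simp
      also have "\<dots> = packed (A \<omega>) (p n)"
        by (simp add: p_def packed_prefix del: upt_Suc sum.lessThan_Suc)
      also have "\<dots> \<le> 1"
        using A \<omega> inst[of n] unfolding randomized_online_algorithm_def online_algorithm_def by simp
      finally show ?thesis
        by (simp add: sum_divide_distrib[symmetric] del: sum.lessThan_Suc)
    qed simp
    \<comment> \<open>Integrality of the number of copies sharpens \<open>< 2\<close> to
      \<open>\<le> 1\<close>.\<close>
    then have "real (\<Sum>i<Suc n. A \<omega> (p i)) < real 2"
      by simp
    then have "(\<Sum>i<Suc n. A \<omega> (p i)) \<le> 1"
      unfolding of_nat_less_iff by linarith
    then have "real (\<Sum>i<Suc n. A \<omega> (p i)) \<le> real 1"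
      unfolding of_nat_le_iff .
    ultimately show ?thesis by simp
  qed
  have int: "integrable M (\<lambda>\<omega>. packed (A \<omega>) (p j))" if "j \<le> n" for j
    using integrable_packed[OF A inst[OF that]] .
  have "?S (gain M A) = (\<integral>\<omega>. ?S (packed (A \<omega>)) \<partial>M)"
    unfolding gain_def using int by (subst Bochner_Integration.integral_add) auto
  also have "\<dots> \<le> (\<integral>\<omega>. 1 \<partial>M)"
    using pathwise
    by (intro integral_mono Bochner_Integration.integrable_add Bochner_Integration.integrable_sum
        integrable_mult_right integrable_divide int) auto
  finally have total: "?S (gain M A) \<le> 1"
    by (simp add: prob_space)
  \<comment> \<open>The last item of \<open>p j\<close> is \<open>x j\<close>, the quantity that the
    hypothesis \<open>gain\<close> compares with the gain on \<open>p j\<close>.\<close>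
  have "1 + (\<Sum>j<n. 1 - x j / x (Suc j)) = ?S last"
  proof -
    have "1 - x j / x (Suc j) = w j * last (p j)" if "j < n" for j
      using pos[of j] that by (simp add: p_def w_def left_diff_distrib)
    moreover have "last (p n) / x n = 1"
      using pos[of n] by (simp add: p_def)
    ultimately show ?thesis by simp
  qed
  \<comment> \<open>The sizes increase, so the weights are nonnegative and the gain bounds can be
    inserted termwise.\<close>
  also have "\<dots> \<le> ?S (\<lambda>xs. c * gain M A xs)"
    using gain w pos[of n]
    by (intro add_mono sum_mono mult_left_mono divide_right_mono)
      (simp_all add: p_def less_imp_le)
  also have "\<dots> = c * ?S (gain M A)"
    by (simp add: sum_distrib_left algebra_simps)
  also have "\<dots> \<le> c"
    using total \<open>0 \<le> c\<close> mult_left_le by blast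
  finally show ?thesis .
qed

lemma le_ratio_gain:
  assumes "knapsack_instance xs" "i < length xs" "0 < xs ! i"
    and "competitive_ratio M A \<le> ereal c"
  shows "xs ! i \<le> c * gain M A xs" "0 \<le> c"
proof -
  have opt: "xs ! i \<le> opt xs" "0 < opt xs"
    using nth_le_opt[OF assms(1,2)] assms(3) by auto
  have "gain M A xs \<ge> 0"
    unfolding gain_def using packed_nonneg[OF assms(1)] by (intro Bochner_Integration.integral_nonneg)
  moreover have ratio: "ereal (opt xs) / ereal (gain M A xs) \<le> ereal c"
    using assms(1,4) unfolding competitive_ratio_def by (meson SUP_le_iff mem_Collect_eq)
  \<comment> \<open>With a positive optimum, zero gain would make the ratio infinite.\<close>
  then have "gain M A xs \<noteq> 0"
    using opt by auto
  ultimately have "gain M A xs > 0" by simp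
  with ratio have *: "opt xs / gain M A xs \<le> c"
    by simp
  with \<open>gain M A xs > 0\<close> opt show "xs ! i \<le> c * gain M A xs"
    by (simp add: field_simps)
  show "0 \<le> c"
    using * \<open>gain M A xs > 0\<close> opt by (smt (verit) divide_pos_pos)
qed

lemma geometric_items_bound:
  assumes "randomized_online_algorithm M A" "competitive_ratio M A \<le> ereal c"
  shows "1 + real n * (1 - 2 powr (- 1 / real (Suc n))) \<le> c"
proof -
  \<comment> \<open>The progression ends at \<open>x n = 1\<close>; the denominator
    \<open>Suc n\<close> instead of \<open>n\<close> keeps \<open>x 0\<close> strictly above
    1/2.\<close>
  define x where "x i = 2 powr ((real i - real n) / real (Suc n))" for i
  have half: "1 / 2 < x i" for i
  proof -
    have "2 powr (-1) < x i"
      unfolding x_def by (intro powr_less_mono) (auto simp: field_simps)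
    then show ?thesis by (simp add: powr_minus)
  qed
  have le1: "x i \<le> 1" if "i \<le> n" for i
  proof -
    have "x i \<le> 2 powr 0"
      unfolding x_def using that by (intro powr_mono) (auto simp: field_simps)
    then show ?thesis by simp
  qed
  have step: "x i / x (Suc i) = 2 powr (- 1 / real (Suc n))" for i
    unfolding x_def powr_diff[symmetric] by (simp add: diff_divide_distrib[symmetric])
  have inst: "knapsack_instance (map x [0..<Suc j])" if "j \<le> n" for j
    using that le1 unfolding knapsack_instance_def
    by (auto simp del: upt_Suc) (simp add: x_def)
  note ratio = le_ratio_gain[OF inst _ _ assms(2)]
  have "1 + (\<Sum>j<n. 1 - x j / x (Suc j)) \<le> c"
  proof (rule increasing_items_bound[OF assms(1) half le1])
    show "x i \<le> x (Suc i)" for i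
      unfolding x_def by (intro powr_mono divide_right_mono) auto
    have "(map x [0..<Suc j]) ! j = x j" for j
      by (simp del: upt_Suc)
    moreover have "0 < x j" for j by (simp add: x_def)
    ultimately show "x j \<le> c * gain M A (map x [0..<Suc j])" if "j \<le> n" for j
      using ratio(1)[OF that, of j] by (simp del: upt_Suc)
    show "0 \<le> c"
      using ratio(2)[of 0 0] by (simp add: x_def)
  qed
  then show ?thesis by (simp add: step)
qed

theorem theorem3:
  fixes M :: "'r measure" and A :: "'r \<Rightarrow> real list \<Rightarrow> nat"
  assumes "randomized_online_algorithm M A"
  shows "ereal (1 + ln 2) \<le> competitive_ratio M A \<and> (1 + ln 2 :: real) > 1.693"
proof
  show "ereal (1 + ln 2) \<le> competitive_ratio M A"
  \<comment> \<open>Comparing with every real upper bound \<open>c\<close> also covers an infinite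
    ratio.\<close>
  proof (rule ereal_le_real)
    fix c assume "competitive_ratio M A \<le> ereal c"
    note geometric_items_bound[OF assms this]
    \<comment> \<open>For small \<open>t\<close>, \<open>1 - 2 powr (-t)\<close> behaves like
      \<open>t * ln 2\<close>; here \<open>t = 1 / Suc n\<close>.\<close>
    moreover have "(\<lambda>n. 1 + real n * (1 - 2 powr (- 1 / real (Suc n)))) \<longlonglongrightarrow> 1 + ln 2"
      by real_asymp
    ultimately show "ereal (1 + ln 2) \<le> ereal c"
      by (simp add: LIMSEQ_le_const2)
  qed
  show "(1 + ln 2 :: real) > 1.693"
    \<comment> \<open>Three terms of ln 2 = 2 * (1/3 + 1/(3 * 3^3) + 1/(5 * 3^5) + ...) already
      exceed 0.693.\<close>
    using ln_approx_bounds[of 2 3] by (simp add: eval_nat_numeral)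
qed

end
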